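(* Let $r\ge1$ and let $(\ell_{ij})_{2\le i\le j\le r}$ be non-negative integers. As meromorphic functions of $(s_{11},s_{12},\dots,s_{1r})\in\mathbb{C}^r$ (i.e. away from singularities), $$\zeta_{\mathrm{A}_r}\bigl((s_{1j})_{1\le j\le r},(-\ell_{ij})_{2\le i\le j\le r}\bigr)=\sum_{\substack{p_{ij}+q_{ij}=\ell_{ij}\\2\le i\le j\le r}}\Bigl(\prod_{2\le i\le j\le r}\binom{\ell_{ij}}{q_{ij}}(-1)^{q_{ij}}\Bigr)\,\zeta_r(\bm{s}(\bm{p},\bm{q})),$$ where the sum runs over all families of non-negative integers $p_{ij},q_{ij}$ ($2\le i\le j\le r$) with $p_{ij}+q_{ij}=\ell_{ij}$, and $$\bm{s}(\bm{p},\bm{q})=\Bigl(s_{1k}-\sum_{i=2}^{k}p_{ik}-\sum_{j=k+1}^{r}q_{k+1,j}\Bigr)_{1\le k\le r},$$ empty sums being $0$.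
   Context: For $\bm{s}=(s_{ij})_{1\le i\le j\le r}$, the zeta function of type $\mathrm{A}_r$ is $\zeta_{\mathrm{A}_r}(\bm{s})=\sum_{m_1,\dots,m_r\ge1}\prod_{1\le i\le j\le r}(m_i+\cdots+m_j)^{-s_{ij}}$, continued meromorphically to $\mathbb{C}^{r(r+1)/2}$. The notation $\zeta_{\mathrm{A}_r}\bigl((s_{1j}),(-\ell_{ij})_{2\le i\le j\le r}\bigr)$ means its value with $s_{ij}=-\ell_{ij}$ for all $2\le i\le j\le r$ and first-row variables $s_{11},\dots,s_{1r}$ free; the series still converges absolutely when the $\mathrm{Re}(s_{1j})$ are sufficiently large, and it is continued meromorphically to $\mathbb{C}^r$. The Euler--Zagier multiple zeta function is $\zeta_r(s_1,\dots,s_r)=\sum_{m_1,\dots,m_r\ge1}\prod_{k=1}^r(m_1+\cdots+m_k)^{-s_k}$, continued meromorphically to $\mathbb{C}^r$. *)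

theory Defs
  imports "HOL-Complex_Analysis.Complex_Analysis"
begin

text \<open>
  A point of $C^r$ is a function on \<open>{1..r}\<close>, \<open>undefined\<close> elsewhere; \<open>cspace r\<close> is $C^r$ with
  its usual topology.
\<close>

abbreviation cspace :: "nat \<Rightarrow> (nat \<Rightarrow> complex) topology" where
  "cspace r \<equiv> product_topology (\<lambda>_. euclidean) {1..r}"

text \<open>
  Holomorphy in several variables: continuous, and complex differentiable in each variable.
\<close>

definition holomorphic_in :: "nat \<Rightarrow> ((nat \<Rightarrow> complex) \<Rightarrow> complex) \<Rightarrow> (nat \<Rightarrow> complex) set \<Rightarrow> bool" where
  "holomorphic_in r f U \<longleftrightarrow>
     openin (cspace r) U \<and>
     continuous_map (subtopology (cspace r) U) euclidean f \<and>
     (\<forall>z\<in>U. \<forall>k\<in>{1..r}. (\<lambda>w. f (z(k := w))) field_differentiable (at (z k)))"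

definition holomorphic_near :: "nat \<Rightarrow> ((nat \<Rightarrow> complex) \<Rightarrow> complex) \<Rightarrow> (nat \<Rightarrow> complex) \<Rightarrow> bool" where
  "holomorphic_near r f a \<longleftrightarrow> (\<exists>U. a \<in> U \<and> holomorphic_in r f U)"

text \<open>
  Meromorphic on $C^r$: locally a quotient of holomorphic functions whose denominator does not
  vanish identically on any nonempty open set. The values of \<open>f\<close> on the zero set of the
  denominator are unconstrained.
\<close>

definition meromorphic_cspace :: "nat \<Rightarrow> ((nat \<Rightarrow> complex) \<Rightarrow> complex) \<Rightarrow> bool" where
  "meromorphic_cspace r f \<longleftrightarrow>
     (\<forall>a\<in>topspace (cspace r). \<exists>U g h.
        a \<in> U \<and> holomorphic_in r g U \<and> holomorphic_in r h U \<and>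
        (\<forall>V. openin (cspace r) V \<and> V \<subseteq> U \<and> V \<noteq> {} \<longrightarrow> (\<exists>z\<in>V. h z \<noteq> 0)) \<and>
        (\<forall>z\<in>U. h z \<noteq> 0 \<longrightarrow> f z = g z / h z))"

text \<open>
  \<open>F\<close> is a meromorphic continuation to $C^r$ of the sum, over all positive integers
  $m_1, \ldots, m_r$, of the terms \<open>T s m\<close>: it is the sum of the series whenever all real parts are
  sufficiently large. For complex terms, \<open>has_sum\<close> amounts to absolute convergence.
\<close>

definition meromorphic_continuation ::
    "nat \<Rightarrow> ((nat \<Rightarrow> complex) \<Rightarrow> (nat \<Rightarrow> nat) \<Rightarrow> complex) \<Rightarrow> ((nat \<Rightarrow> complex) \<Rightarrow> complex) \<Rightarrow> bool" where
  "meromorphic_continuation r T F \<longleftrightarrow>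
     meromorphic_cspace r F \<and>
     (\<exists>c::real. \<forall>s\<in>topspace (cspace r). (\<forall>k\<in>{1..r}. c < Re (s k)) \<longrightarrow>
        (T s has_sum F s) ({1..r} \<rightarrow>\<^sub>E {1..}))"

text \<open>
  Two continuations of the same series agree where both are holomorphic, but may differ on a nowhere
  dense set, where their values are unconstrained. A point is regular if some continuation is
  holomorphic near it, and the value there is that of any such continuation.
\<close>

definition continuation_regular ::
    "nat \<Rightarrow> ((nat \<Rightarrow> complex) \<Rightarrow> (nat \<Rightarrow> nat) \<Rightarrow> complex) \<Rightarrow> (nat \<Rightarrow> complex) \<Rightarrow> bool" where
  "continuation_regular r T s \<longleftrightarrow>
     (\<exists>F. meromorphic_continuation r T F \<and> holomorphic_near r F s)"

definition continuation_value ::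
    "nat \<Rightarrow> ((nat \<Rightarrow> complex) \<Rightarrow> (nat \<Rightarrow> nat) \<Rightarrow> complex) \<Rightarrow> (nat \<Rightarrow> complex) \<Rightarrow> complex" where
  "continuation_value r T s =
     (THE v. \<exists>F. meromorphic_continuation r T F \<and> holomorphic_near r F s \<and> F s = v)"

definition zeta_A_term :: "nat \<Rightarrow> (nat \<times> nat \<Rightarrow> complex) \<Rightarrow> (nat \<Rightarrow> nat) \<Rightarrow> complex" where
  "zeta_A_term r s m =
     (\<Prod>(i, j)\<in>{(i, j). 1 \<le> i \<and> i \<le> j \<and> j \<le> r}. of_nat (\<Sum>k=i..j. m k) powr (- s (i, j)))"

text \<open>The variables of the type A zeta function with only the first row left free.\<close>

definition first_row_vars :: "(nat \<times> nat \<Rightarrow> nat) \<Rightarrow> (nat \<Rightarrow> complex) \<Rightarrow> nat \<times> nat \<Rightarrow> complex" where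
  "first_row_vars l s = (\<lambda>(i, j). if i = 1 then s j else - of_nat (l (i, j)))"

definition zeta_A_row :: "nat \<Rightarrow> (nat \<times> nat \<Rightarrow> nat) \<Rightarrow> (nat \<Rightarrow> complex) \<Rightarrow> complex" where
  "zeta_A_row r l = continuation_value r (\<lambda>s. zeta_A_term r (first_row_vars l s))"

definition zeta_A_row_regular :: "nat \<Rightarrow> (nat \<times> nat \<Rightarrow> nat) \<Rightarrow> (nat \<Rightarrow> complex) \<Rightarrow> bool" where
  "zeta_A_row_regular r l = continuation_regular r (\<lambda>s. zeta_A_term r (first_row_vars l s))"

definition zeta_EZ_term :: "nat \<Rightarrow> (nat \<Rightarrow> complex) \<Rightarrow> (nat \<Rightarrow> nat) \<Rightarrow> complex" where
  "zeta_EZ_term r s m = (\<Prod>k=1..r. of_nat (\<Sum>i=1..k. m i) powr (- s k))"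

definition zeta_EZ :: "nat \<Rightarrow> (nat \<Rightarrow> complex) \<Rightarrow> complex" where
  "zeta_EZ r = continuation_value r (zeta_EZ_term r)"

definition zeta_EZ_regular :: "nat \<Rightarrow> (nat \<Rightarrow> complex) \<Rightarrow> bool" where
  "zeta_EZ_regular r = continuation_regular r (zeta_EZ_term r)"

definition lower_pairs :: "nat \<Rightarrow> (nat \<times> nat) set" where
  "lower_pairs r = {(i, j). 2 \<le> i \<and> i \<le> j \<and> j \<le> r}"

text \<open>Families on \<open>lower_pairs r\<close> are extensional, so that each is counted exactly once.\<close>

definition splittings :: "nat \<Rightarrow> (nat \<times> nat \<Rightarrow> nat) \<Rightarrow> ((nat \<times> nat \<Rightarrow> nat) \<times> (nat \<times> nat \<Rightarrow> nat)) set" where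
  "splittings r l =
     {(p, q). p \<in> lower_pairs r \<rightarrow>\<^sub>E UNIV \<and> q \<in> lower_pairs r \<rightarrow>\<^sub>E UNIV \<and>
              (\<forall>x\<in>lower_pairs r. p x + q x = l x)}"

definition shifted_vars ::
    "nat \<Rightarrow> (nat \<Rightarrow> complex) \<Rightarrow> (nat \<times> nat \<Rightarrow> nat) \<Rightarrow> (nat \<times> nat \<Rightarrow> nat) \<Rightarrow> nat \<Rightarrow> complex" where
  "shifted_vars r s p q =
     (\<lambda>k\<in>{1..r}. s k - (\<Sum>i=2..k. of_nat (p (i, k))) - (\<Sum>j=k+1..r. of_nat (q (k + 1, j))))"

end

theory Submission
  imports Defs
begin

text \<open>
  With $M_k = m_1 + \cdots + m_k$, each factor $(m_i + \cdots + m_j)^{\ell_{ij}} = (M_j - M_{i-1})^{\ell_{ij}}$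
  expands by the binomial theorem, so the type A series is termwise the stated finite combination of
  Euler--Zagier series at translated arguments. The same combination of continuations of these
  is then a continuation of the type A series. Its value is independent of the continuations
  chosen: a meromorphic function vanishing on a nonempty open set vanishes generically near every
  point, because the set of points with this property is open and closed in the connected
  space $C^r$; at a point of holomorphy it then vanishes by continuity.
\<close>

declare One_nat_def [simp del] \<comment> \<open>otherwise \<open>{1..r}\<close> becomes \<open>{Suc 0..r}\<close> and stops matching \<open>cspace r\<close>\<close>

section \<open>Holomorphic and meromorphic functions of several variables\<close>

lemma continuous_map_mult:
  fixes f g :: "'a \<Rightarrow> 'b::real_normed_algebra"
  shows "continuous_map X euclidean f \<Longrightarrow> continuous_map X euclidean g \<Longrightarrow>
    continuous_map X euclidean (\<lambda>x. f x * g x)"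
  by (simp add: continuous_map_atin tendsto_mult)

section \<open>Boxes as basic open sets of C^r\<close>

lemma openin_cspace_box:
  assumes "\<And>k. k \<in> {1..r} \<Longrightarrow> open (B k)"
  shows "openin (cspace r) (Pi\<^sub>E {1..r} B)"
  using assms by (simp add: openin_PiE)

text \<open>Each factor of a basic open set around \<open>a\<close> is shrunk to a ball. Balls are
  connected, which the one-variable identity theorem will need.\<close>

lemma openin_cspace_contains_box:
  assumes "openin (cspace r) U" "a \<in> U"
  obtains B where "\<And>k. k \<in> {1..r} \<Longrightarrow> open (B k)" "\<And>k. k \<in> {1..r} \<Longrightarrow> connected (B k)"
    "a \<in> Pi\<^sub>E {1..r} B" "Pi\<^sub>E {1..r} B \<subseteq> U"
proof -
  obtain W where W: "\<forall>k\<in>{1..r}. open (W k)" "a \<in> Pi\<^sub>E {1..r} W" "Pi\<^sub>E {1..r} W \<subseteq> U"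
    using assms unfolding openin_product_topology_alt by auto
  have "\<exists>e>0. ball (a k) e \<subseteq> W k" if "k \<in> {1..r}" for k
    using W that by (meson PiE_mem open_contains_ball)
  then obtain e where e: "\<And>k. k \<in> {1..r} \<Longrightarrow> e k > 0 \<and> ball (a k) (e k) \<subseteq> W k"
    by metis
  show thesis
  proof (rule that[of "\<lambda>k. ball (a k) (e k)"])
    show "a \<in> (\<Pi>\<^sub>E k\<in>{1..r}. ball (a k) (e k))"
      using W(2) e by (auto simp: PiE_iff)
    have "(\<Pi>\<^sub>E k\<in>{1..r}. ball (a k) (e k)) \<subseteq> Pi\<^sub>E {1..r} W"
      using e by (intro PiE_mono) blast
    then show "(\<Pi>\<^sub>E k\<in>{1..r}. ball (a k) (e k)) \<subseteq> U"
      using W(3) by blast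
  qed auto
qed

section \<open>Basic properties of holomorphic functions\<close>

lemma holomorphic_in_openin: "holomorphic_in r f U \<Longrightarrow> openin (cspace r) U"
  by (simp add: holomorphic_in_def)

lemma holomorphic_in_field_differentiable:
  assumes "holomorphic_in r f U" "z \<in> U" "k \<in> {1..r}"
  shows "(\<lambda>w. f (z(k := w))) field_differentiable at (z k)"
proof -
  have "\<forall>z\<in>U. \<forall>k\<in>{1..r}. (\<lambda>w. f (z(k := w))) field_differentiable (at (z k))"
    using assms(1) unfolding holomorphic_in_def by (elim conjE)
  from bspec[OF bspec[OF this assms(2)] assms(3)] show ?thesis .
qed

lemma holomorphic_in_subset_topspace: "holomorphic_in r f U \<Longrightarrow> U \<subseteq> topspace (cspace r)"
  by (metis holomorphic_in_openin openin_subset)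

lemma holomorphic_in_mono:
  "holomorphic_in r f U \<Longrightarrow> openin (cspace r) V \<Longrightarrow> V \<subseteq> U \<Longrightarrow> holomorphic_in r f V"
  unfolding holomorphic_in_def by (blast intro: continuous_map_from_subtopology_mono)

lemma holomorphic_in_const: "openin (cspace r) U \<Longrightarrow> holomorphic_in r (\<lambda>_. c) U"
  unfolding holomorphic_in_def by simp

lemma holomorphic_in_add:
  "holomorphic_in r f U \<Longrightarrow> holomorphic_in r g U \<Longrightarrow> holomorphic_in r (\<lambda>z. f z + g z) U"
  unfolding holomorphic_in_def by (auto intro: continuous_map_add field_differentiable_add)

lemma holomorphic_in_mult:
  "holomorphic_in r f U \<Longrightarrow> holomorphic_in r g U \<Longrightarrow> holomorphic_in r (\<lambda>z. f z * g z) U"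
  unfolding holomorphic_in_def by (auto intro: continuous_map_mult field_differentiable_mult)

lemma openin_holomorphic_nonzero:
  assumes "holomorphic_in r f U"
  shows "openin (cspace r) {z \<in> U. f z \<noteq> 0}"
proof -
  have U: "openin (cspace r) U"
    using assms by (rule holomorphic_in_openin)
  have "openin (subtopology (cspace r) U) {z \<in> topspace (subtopology (cspace r) U). f z \<in> - {0}}"
    using assms unfolding holomorphic_in_def by (intro openin_continuous_map_preimage) auto
  moreover have "topspace (subtopology (cspace r) U) = U"
    using openin_subset[OF U] by (rule topspace_subtopology_subset)
  ultimately have "openin (subtopology (cspace r) U) {z \<in> U. f z \<noteq> 0}"
    by (simp del: topspace_subtopology)
  then show ?thesis
    using U by (rule openin_trans_full)
qed

lemma holomorphic_near_const: "a \<in> topspace (cspace r) \<Longrightarrow> holomorphic_near r (\<lambda>_. c) a"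
  unfolding holomorphic_near_def using holomorphic_in_const openin_topspace by blast

lemma holomorphic_near_common:
  assumes "holomorphic_near r f a" "holomorphic_near r g a"
  shows "\<exists>U. a \<in> U \<and> holomorphic_in r f U \<and> holomorphic_in r g U"
proof -
  obtain U V where U: "a \<in> U" "holomorphic_in r f U" and V: "a \<in> V" "holomorphic_in r g V"
    using assms unfolding holomorphic_near_def by blast
  have "openin (cspace r) (U \<inter> V)"
    using U V by (intro openin_Int) (auto dest: holomorphic_in_openin)
  then show ?thesis
    using U V by (intro exI[of _ "U \<inter> V"]) (auto intro: holomorphic_in_mono)
qed

lemma holomorphic_near_add:
  "holomorphic_near r f a \<Longrightarrow> holomorphic_near r g a \<Longrightarrow> holomorphic_near r (\<lambda>z. f z + g z) a"
  using holomorphic_near_common[of r f a g] holomorphic_in_add[of r f _ g]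
  unfolding holomorphic_near_def[of r "\<lambda>z. f z + g z"] by blast

lemma holomorphic_near_mult:
  "holomorphic_near r f a \<Longrightarrow> holomorphic_near r g a \<Longrightarrow> holomorphic_near r (\<lambda>z. f z * g z) a"
  using holomorphic_near_common[of r f a g] holomorphic_in_mult[of r f _ g]
  unfolding holomorphic_near_def[of r "\<lambda>z. f z * g z"] by blast

text \<open>The condition on denominators in \<open>meromorphic_cspace\<close>: for open
  \<open>U\<close>, the zeros of \<open>h\<close> in \<open>U\<close> have empty interior. As
  \<open>U\<close> may be disconnected, this says more than that \<open>h\<close> is not identically
  zero.\<close>

definition generically_nonzero :: "nat \<Rightarrow> ((nat \<Rightarrow> complex) \<Rightarrow> complex) \<Rightarrow> (nat \<Rightarrow> complex) set \<Rightarrow> bool" where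
  "generically_nonzero r h U \<longleftrightarrow>
     (\<forall>V. openin (cspace r) V \<and> V \<subseteq> U \<and> V \<noteq> {} \<longrightarrow> (\<exists>z\<in>V. h z \<noteq> 0))"

lemma generically_nonzero_mono:
  "generically_nonzero r h U \<Longrightarrow> V \<subseteq> U \<Longrightarrow> generically_nonzero r h V"
  unfolding generically_nonzero_def by blast

text \<open>Inside any open \<open>V\<close> the points with \<open>h z \<noteq> 0\<close> form a
  nonempty open set, by continuity of \<open>h\<close>; the condition on \<open>k\<close> then
  applies to that set.\<close>

lemma generically_nonzero_mult:
  assumes "holomorphic_in r h U" "generically_nonzero r h U" "generically_nonzero r k U"
  shows "generically_nonzero r (\<lambda>z. h z * k z) U"
  unfolding generically_nonzero_def
proof (intro allI impI, elim conjE)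
  fix V assume V: "openin (cspace r) V" "V \<subseteq> U" "V \<noteq> {}"
  have "openin (cspace r) {z \<in> V. h z \<noteq> 0}"
    using V by (intro openin_holomorphic_nonzero holomorphic_in_mono[OF assms(1)])
  moreover have "{z \<in> V. h z \<noteq> 0} \<noteq> {}"
    using assms(2) V unfolding generically_nonzero_def by blast
  moreover have "{z \<in> V. h z \<noteq> 0} \<subseteq> U"
    using V by blast
  ultimately obtain z where "z \<in> V" "h z \<noteq> 0" "k z \<noteq> 0"
    using assms(3) unfolding generically_nonzero_def by blast
  then show "\<exists>z\<in>V. h z * k z \<noteq> 0"
    by auto
qed

text \<open>The local data of \<open>meromorphic_cspace\<close>, bundled so that two functions can
  be compared on one common neighbourhood.\<close>

definition quotient_on :: "nat \<Rightarrow> ((nat \<Rightarrow> complex) \<Rightarrow> complex) \<Rightarrow> ((nat \<Rightarrow> complex) \<Rightarrow> complex) \<Rightarrow>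
    ((nat \<Rightarrow> complex) \<Rightarrow> complex) \<Rightarrow> (nat \<Rightarrow> complex) set \<Rightarrow> bool" where
  "quotient_on r f g h U \<longleftrightarrow>
     holomorphic_in r g U \<and> holomorphic_in r h U \<and> generically_nonzero r h U \<and>
     (\<forall>z\<in>U. h z \<noteq> 0 \<longrightarrow> f z = g z / h z)"

lemma meromorphic_cspace_iff:
  "meromorphic_cspace r f \<longleftrightarrow>
     (\<forall>a\<in>topspace (cspace r). \<exists>U g h. a \<in> U \<and> quotient_on r f g h U)"
  unfolding meromorphic_cspace_def generically_nonzero_def quotient_on_def ..

lemma quotient_on_mono:
  assumes "quotient_on r f g h U" "openin (cspace r) V" "V \<subseteq> U"
  shows "quotient_on r f g h V"
  using assms holomorphic_in_mono[OF _ assms(2,3)] generically_nonzero_mono[OF _ assms(3)]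
  unfolding quotient_on_def by blast

text \<open>The common denominator is nonzero only where \<open>h1\<close> and \<open>h2\<close>
  both are, so both representations are available there.\<close>

lemma quotient_on_add:
  assumes "quotient_on r f1 g1 h1 U" "quotient_on r f2 g2 h2 U"
  shows "quotient_on r (\<lambda>z. f1 z + f2 z) (\<lambda>z. g1 z * h2 z + g2 z * h1 z) (\<lambda>z. h1 z * h2 z) U"
  unfolding quotient_on_def
proof (intro conjI)
  show "holomorphic_in r (\<lambda>z. g1 z * h2 z + g2 z * h1 z) U"
    using assms unfolding quotient_on_def by (intro holomorphic_in_add holomorphic_in_mult) blast+
  show "holomorphic_in r (\<lambda>z. h1 z * h2 z) U"
    using assms unfolding quotient_on_def by (intro holomorphic_in_mult) blast+
  show "generically_nonzero r (\<lambda>z. h1 z * h2 z) U"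
    using assms unfolding quotient_on_def by (intro generically_nonzero_mult) blast+
  show "\<forall>z\<in>U. h1 z * h2 z \<noteq> 0 \<longrightarrow> f1 z + f2 z = (g1 z * h2 z + g2 z * h1 z) / (h1 z * h2 z)"
    using assms unfolding quotient_on_def by (simp add: add_frac_eq)
qed

lemma quotient_on_mult:
  assumes "quotient_on r f1 g1 h1 U" "quotient_on r f2 g2 h2 U"
  shows "quotient_on r (\<lambda>z. f1 z * f2 z) (\<lambda>z. g1 z * g2 z) (\<lambda>z. h1 z * h2 z) U"
  unfolding quotient_on_def
proof (intro conjI)
  show "holomorphic_in r (\<lambda>z. g1 z * g2 z) U"
    using assms unfolding quotient_on_def by (intro holomorphic_in_mult) blast+
  show "holomorphic_in r (\<lambda>z. h1 z * h2 z) U"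
    using assms unfolding quotient_on_def by (intro holomorphic_in_mult) blast+
  show "generically_nonzero r (\<lambda>z. h1 z * h2 z) U"
    using assms unfolding quotient_on_def by (intro generically_nonzero_mult) blast+
  show "\<forall>z\<in>U. h1 z * h2 z \<noteq> 0 \<longrightarrow> f1 z * f2 z = (g1 z * g2 z) / (h1 z * h2 z)"
    using assms unfolding quotient_on_def by simp
qed

section \<open>Closure properties of meromorphic functions\<close>

lemma meromorphic_cspace_const: "meromorphic_cspace r (\<lambda>_. c)"
proof -
  have "generically_nonzero r (\<lambda>_. 1) (topspace (cspace r))"
    unfolding generically_nonzero_def by auto
  then have "quotient_on r (\<lambda>_. c) (\<lambda>_. c) (\<lambda>_. 1) (topspace (cspace r))"
    unfolding quotient_on_def by (simp add: holomorphic_in_const del: topspace_product_topology)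
  then show ?thesis
    unfolding meromorphic_cspace_iff by blast
qed

lemma meromorphic_cspace_common:
  assumes "meromorphic_cspace r f1" "meromorphic_cspace r f2" "a \<in> topspace (cspace r)"
  shows "\<exists>U g1 h1 g2 h2. a \<in> U \<and> quotient_on r f1 g1 h1 U \<and> quotient_on r f2 g2 h2 U"
proof -
  obtain U g1 h1 where 1: "a \<in> U" "quotient_on r f1 g1 h1 U"
    using assms(1,3) unfolding meromorphic_cspace_iff by blast
  obtain V g2 h2 where 2: "a \<in> V" "quotient_on r f2 g2 h2 V"
    using assms(2,3) unfolding meromorphic_cspace_iff by blast
  have "openin (cspace r) (U \<inter> V)"
    using 1 2 unfolding quotient_on_def by (intro openin_Int) (auto dest: holomorphic_in_openin)
  then have "quotient_on r f1 g1 h1 (U \<inter> V)" "quotient_on r f2 g2 h2 (U \<inter> V)"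
    using 1 2 by (auto intro: quotient_on_mono)
  then show ?thesis
    using 1 2 by blast
qed

lemma meromorphic_cspace_add:
  assumes "meromorphic_cspace r f1" "meromorphic_cspace r f2"
  shows "meromorphic_cspace r (\<lambda>z. f1 z + f2 z)"
  unfolding meromorphic_cspace_iff
proof
  fix a assume "a \<in> topspace (cspace r)"
  then obtain U g1 h1 g2 h2 where U: "a \<in> U" and q: "quotient_on r f1 g1 h1 U" "quotient_on r f2 g2 h2 U"
    using meromorphic_cspace_common[OF assms] by blast
  show "\<exists>U g h. a \<in> U \<and> quotient_on r (\<lambda>z. f1 z + f2 z) g h U"
    using U quotient_on_add[OF q] by (intro exI conjI)
qed

lemma meromorphic_cspace_mult:
  assumes "meromorphic_cspace r f1" "meromorphic_cspace r f2"
  shows "meromorphic_cspace r (\<lambda>z. f1 z * f2 z)"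
  unfolding meromorphic_cspace_iff
proof
  fix a assume "a \<in> topspace (cspace r)"
  then obtain U g1 h1 g2 h2 where U: "a \<in> U" and q: "quotient_on r f1 g1 h1 U" "quotient_on r f2 g2 h2 U"
    using meromorphic_cspace_common[OF assms] by blast
  show "\<exists>U g h. a \<in> U \<and> quotient_on r (\<lambda>z. f1 z * f2 z) g h U"
    using U quotient_on_mult[OF q] by (intro exI conjI)
qed

section \<open>Translations\<close>

text \<open>Restricting to \<open>{1..r}\<close> keeps the result extensional, hence a point of
  \<open>cspace r\<close>.\<close>

definition translate :: "nat \<Rightarrow> (nat \<Rightarrow> complex) \<Rightarrow> (nat \<Rightarrow> complex) \<Rightarrow> nat \<Rightarrow> complex" where
  "translate r c s = (\<lambda>k\<in>{1..r}. s k + c k)"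

lemma translate_in_topspace [simp]: "translate r c s \<in> topspace (cspace r)"
  by (simp add: translate_def)

text \<open>Turns differentiability in the \<open>k\<close>-th variable at \<open>z k\<close> into
  differentiability at \<open>z k + c k\<close>, composed with a shift of one variable.\<close>

lemma translate_upd:
  "k \<in> {1..r} \<Longrightarrow> translate r c (z(k := w)) = (translate r c z)(k := w + c k)"
  by (auto simp: translate_def fun_eq_iff)

text \<open>Extensionality of \<open>z\<close> gives equality also outside \<open>{1..r}\<close>,
  where every translate is \<open>undefined\<close>.\<close>

lemma translate_translate_minus:
  "z \<in> topspace (cspace r) \<Longrightarrow> translate r c (translate r (\<lambda>k. - c k) z) = z"
  "z \<in> topspace (cspace r) \<Longrightarrow> translate r (\<lambda>k. - c k) (translate r c z) = z"
  by (auto simp: translate_def fun_eq_iff PiE_iff extensional_def)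

lemma continuous_map_translate: "continuous_map (cspace r) (cspace r) (translate r c)"
  unfolding continuous_map_componentwise
proof
  show "translate r c ` topspace (cspace r) \<subseteq> extensional {1..r}"
    by (auto simp: translate_def)
  show "\<forall>k\<in>{1..r}. continuous_map (cspace r) euclidean (\<lambda>s. translate r c s k)"
  proof
    fix k assume k: "k \<in> {1..r}"
    have "continuous_map (cspace r) euclidean (\<lambda>s. s k + c k)"
      using k by (intro continuous_map_add continuous_map_product_projection) auto
    then show "continuous_map (cspace r) euclidean (\<lambda>s. translate r c s k)"
      using k by (simp add: translate_def)
  qed
qed

lemma openin_translate_vimage:
  "openin (cspace r) U \<Longrightarrow> openin (cspace r) {z \<in> topspace (cspace r). translate r c z \<in> U}"
  by (rule openin_continuous_map_preimage[OF continuous_map_translate])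

lemma holomorphic_in_translate:
  assumes "holomorphic_in r f U"
  shows "holomorphic_in r (\<lambda>z. f (translate r c z)) {z \<in> topspace (cspace r). translate r c z \<in> U}"
    (is "holomorphic_in r _ ?W")
  unfolding holomorphic_in_def
proof (intro conjI ballI)
  show "openin (cspace r) ?W"
    using assms by (intro openin_translate_vimage holomorphic_in_openin)
  have "continuous_map (subtopology (cspace r) ?W) (subtopology (cspace r) U) (translate r c)"
    unfolding continuous_map_in_subtopology
    using continuous_map_from_subtopology[OF continuous_map_translate] by auto
  then have "continuous_map (subtopology (cspace r) ?W) euclidean (f \<circ> translate r c)"
    by (rule continuous_map_compose) (use assms in \<open>simp add: holomorphic_in_def\<close>)
  then show "continuous_map (subtopology (cspace r) ?W) euclidean (\<lambda>z. f (translate r c z))"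
    by (simp add: o_def)
  fix z k assume z: "z \<in> ?W" and k: "k \<in> {1..r}"
  have 1: "(\<lambda>w. f ((translate r c z)(k := w))) field_differentiable at (z k + c k)"
    using holomorphic_in_field_differentiable[OF assms, of "translate r c z"] z k
    by (simp add: translate_def)
  have 2: "(\<lambda>w. w + c k) field_differentiable at (z k)"
    by (intro derivative_intros)
  have "((\<lambda>w. f ((translate r c z)(k := w))) \<circ> (\<lambda>w. w + c k)) field_differentiable at (z k)"
    using 2 1 by (rule field_differentiable_compose)
  then show "(\<lambda>w. f (translate r c (z(k := w)))) field_differentiable at (z k)"
    using k by (simp add: o_def translate_upd)
qed

lemma holomorphic_near_translate:
  assumes "holomorphic_near r f (translate r c a)" "a \<in> topspace (cspace r)"
  shows "holomorphic_near r (\<lambda>z. f (translate r c z)) a"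
proof -
  obtain U where U: "translate r c a \<in> U" "holomorphic_in r f U"
    using assms(1) unfolding holomorphic_near_def by blast
  have "a \<in> {z \<in> topspace (cspace r). translate r c z \<in> U}"
    using U(1) assms(2) by blast
  then show ?thesis
    using holomorphic_in_translate[OF U(2), of c] unfolding holomorphic_near_def by (intro exI conjI)
qed

lemma meromorphic_cspace_translate:
  assumes "meromorphic_cspace r f"
  shows "meromorphic_cspace r (\<lambda>z. f (translate r c z))"
  unfolding meromorphic_cspace_iff
proof
  fix a assume a: "a \<in> topspace (cspace r)"
  obtain U g h where *: "translate r c a \<in> U" "holomorphic_in r g U" "holomorphic_in r h U"
    "generically_nonzero r h U" "\<And>z. z \<in> U \<Longrightarrow> h z \<noteq> 0 \<Longrightarrow> f z = g z / h z"
    using bspec[OF assms[unfolded meromorphic_cspace_iff quotient_on_def] translate_in_topspace[of r c a]]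
    by blast
  let ?W = "{z \<in> topspace (cspace r). translate r c z \<in> U}"
  have "generically_nonzero r (\<lambda>z. h (translate r c z)) ?W"
    unfolding generically_nonzero_def
  proof (intro allI impI, elim conjE)
    fix V assume V: "openin (cspace r) V" "V \<subseteq> ?W" "V \<noteq> {}"
    \<comment> \<open>This is the image of \<open>V\<close> under translation by \<open>c\<close>,
      written as a preimage under the inverse translation so that its openness follows from
      continuity.\<close>
    let ?V = "{z \<in> topspace (cspace r). translate r (\<lambda>k. - c k) z \<in> V}"
    obtain v where v: "v \<in> V" "v \<in> topspace (cspace r)"
      using V by blast
    have "openin (cspace r) ?V"
      using V(1) by (rule openin_translate_vimage)
    moreover have "translate r c v \<in> ?V"
      using v translate_translate_minus(2)[OF v(2)] translate_in_topspace by simp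
    moreover have "?V \<subseteq> U"
    proof safe
      fix z assume z: "z \<in> topspace (cspace r)" "translate r (\<lambda>k. - c k) z \<in> V"
      then have "translate r c (translate r (\<lambda>k. - c k) z) \<in> U"
        using V(2) by blast
      then show "z \<in> U"
        using translate_translate_minus(1)[OF z(1)] by simp
    qed
    ultimately obtain z where "z \<in> ?V" "h z \<noteq> 0"
      using *(4) unfolding generically_nonzero_def by blast
    then show "\<exists>z\<in>V. h (translate r c z) \<noteq> 0"
      by (intro bexI[of _ "translate r (\<lambda>k. - c k) z"]) (simp_all add: translate_translate_minus)
  qed
  then have "quotient_on r (\<lambda>z. f (translate r c z)) (\<lambda>z. g (translate r c z))
      (\<lambda>z. h (translate r c z)) ?W"
    using holomorphic_in_translate[OF *(2)] holomorphic_in_translate[OF *(3)] *(5)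
    unfolding quotient_on_def by simp
  moreover have "a \<in> ?W"
    using *(1) a by blast
  ultimately show "\<exists>U g h. a \<in> U \<and> quotient_on r (\<lambda>z. f (translate r c z)) g h U"
    by (intro exI conjI)
qed

section \<open>The identity theorem\<close>

text \<open>
  The variables are moved one at a time from the small box to the large one, so that only the
  identity theorem in one variable is needed.
\<close>

lemma holomorphic_in_box_identity:
  assumes g: "holomorphic_in r g U" and B: "\<And>k. k \<in> {1..r} \<Longrightarrow> open (B k)"
    "\<And>k. k \<in> {1..r} \<Longrightarrow> connected (B k)" "Pi\<^sub>E {1..r} B \<subseteq> U"
    and N: "openin (cspace r) N" "N \<noteq> {}" "N \<subseteq> Pi\<^sub>E {1..r} B" "\<And>z. z \<in> N \<Longrightarrow> g z = 0"
    and z: "z \<in> Pi\<^sub>E {1..r} B"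
  shows "g z = 0"
proof -
  obtain b where b: "b \<in> N"
    using N by blast
  obtain C where C: "\<And>k. k \<in> {1..r} \<Longrightarrow> open (C k)" "b \<in> Pi\<^sub>E {1..r} C" "Pi\<^sub>E {1..r} C \<subseteq> N"
    using openin_cspace_contains_box[OF N(1) b] by metis
  \<comment> \<open>The box of the \<open>C k\<close> contains \<open>b\<close>; an inclusion
    between boxes passes to the factors once the smaller box is nonempty.\<close>
  have CB: "C k \<subseteq> B k" if "k \<in> {1..r}" for k
    using that C N(3) subset_PiE[of "{1..r}" C B] by blast
  have C_ne: "C k \<noteq> {}" if "k \<in> {1..r}" for k
    using that C(2) by auto
  \<comment> \<open>The first \<open>j\<close> coordinates range over the large box, the others over
    the small one: \<open>P 0\<close> is the box of the \<open>C k\<close> and \<open>P r\<close>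
    that of the \<open>B k\<close>.\<close>
  define P where "P j = (\<Pi>\<^sub>E k\<in>{1..r}. if k \<le> j then B k else C k)" for j
  have "\<forall>z\<in>P j. g z = 0" if "j \<le> r" for j
    using that
  proof (induction j)
    case 0
    have "P 0 = Pi\<^sub>E {1..r} C"
      unfolding P_def by (intro PiE_cong) auto
    then show ?case
      using C N by blast
  next
    case (Suc j)
    show ?case
    proof
      fix z assume z: "z \<in> P (Suc j)"
      have k: "Suc j \<in> {1..r}"
        using Suc.prems by auto
      have ext: "z i = undefined" if "i \<notin> {1..r}" for i
        using z that unfolding P_def by (rule PiE_arb)
      have zi: "z i \<in> (if i \<le> Suc j then B i else C i)" if "i \<in> {1..r}" for i
        using z that unfolding P_def by (rule PiE_mem)
      have zB: "z i \<in> B i" if "i \<in> {1..r}" for i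
        using CB[OF that] zi[OF that] by (auto split: if_splits)
      have zU: "z(Suc j := w) \<in> U" if w: "w \<in> B (Suc j)" for w
      proof -
        have "z(Suc j := w) \<in> Pi\<^sub>E {1..r} B"
        proof (rule PiE_I)
          show "(z(Suc j := w)) i \<in> B i" if "i \<in> {1..r}" for i
            using zB[OF that] w by (cases "i = Suc j") simp_all
          show "(z(Suc j := w)) i = undefined" if "i \<notin> {1..r}" for i
            using ext[OF that] that k by (cases "i = Suc j") simp_all
        qed
        then show ?thesis
          using B(3) by (rule rev_subsetD)
      qed
      have zP: "z(Suc j := w) \<in> P j" if w: "w \<in> C (Suc j)" for w
        unfolding P_def
      proof (rule PiE_I)
        show "(z(Suc j := w)) i \<in> (if i \<le> j then B i else C i)" if "i \<in> {1..r}" for i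
          using zi[OF that] w by (cases "i = Suc j") (auto split: if_splits)
        show "(z(Suc j := w)) i = undefined" if "i \<notin> {1..r}" for i
          using ext[OF that] that k by (cases "i = Suc j") simp_all
      qed
      \<comment> \<open>With the other coordinates of \<open>z\<close> fixed, \<open>g\<close> is
        holomorphic in this variable on the connected set \<open>B (Suc j)\<close> and vanishes on
        its nonempty open subset \<open>C (Suc j)\<close> by induction.\<close>
      have "g (z(Suc j := w)) = 0" if w: "w \<in> B (Suc j)" for w
      proof (rule analytic_continuation_open[where s = "C (Suc j)" and s' = "B (Suc j)"
            and f = "\<lambda>w. g (z(Suc j := w))" and g = "\<lambda>_. 0"])
        show "(\<lambda>w. g (z(Suc j := w))) holomorphic_on B (Suc j)"
        proof (rule holomorphic_onI)
          fix x assume "x \<in> B (Suc j)"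
          then have "z(Suc j := x) \<in> U"
            by (rule zU)
          from holomorphic_in_field_differentiable[OF g this k]
          have "(\<lambda>w. g (z(Suc j := w))) field_differentiable at x"
            by simp
          then show "(\<lambda>w. g (z(Suc j := w))) field_differentiable at x within B (Suc j)"
            by (rule field_differentiable_at_within)
        qed
        show "g (z(Suc j := x)) = 0" if "x \<in> C (Suc j)" for x
          using zP[OF that] Suc.IH Suc.prems by simp
      qed (simp_all add: w B(1,2)[OF k] C(1)[OF k] CB[OF k] C_ne[OF k])
      from this[of "z (Suc j)"] show "g z = 0"
        using zB k by simp
    qed
  qed
  moreover have "P r = Pi\<^sub>E {1..r} B"
    unfolding P_def by (intro PiE_cong) auto
  ultimately show ?thesis
    using z by blast
qed

text \<open>The zeros of \<open>f\<close> are dense in some neighbourhood of \<open>a\<close>.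
  Vanishing throughout a neighbourhood would be too strong, because the values of a meromorphic
  \<open>f\<close> at zeros of its local denominators are unconstrained.\<close>

definition generically_zero_near :: "nat \<Rightarrow> ((nat \<Rightarrow> complex) \<Rightarrow> complex) \<Rightarrow> (nat \<Rightarrow> complex) \<Rightarrow> bool" where
  "generically_zero_near r f a \<longleftrightarrow> (\<exists>W. openin (cspace r) W \<and> a \<in> W \<and>
     (\<forall>V. openin (cspace r) V \<and> V \<subseteq> W \<and> V \<noteq> {} \<longrightarrow> (\<exists>z\<in>V. f z = 0)))"

text \<open>A neighbourhood \<open>W\<close> that works for \<open>a\<close> works for each of its
  points.\<close>

lemma openin_generically_zero: "openin (cspace r) {a. generically_zero_near r f a}"
proof (subst openin_subopen, safe)
  fix a assume "generically_zero_near r f a"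
  then show "\<exists>T. openin (cspace r) T \<and> a \<in> T \<and> T \<subseteq> {a. generically_zero_near r f a}"
    unfolding generically_zero_near_def by blast
qed

text \<open>Near a limit point \<open>a\<close>, write \<open>f\<close> as \<open>g / h\<close> on a
  box. The box meets the set in some \<open>b\<close>, and density of the zeros of \<open>f\<close>
  near \<open>b\<close> makes \<open>g\<close> vanish on an open set, hence on the whole box. So
  \<open>f\<close> vanishes in the box wherever \<open>h\<close> does not, and such points are
  dense.\<close>

lemma closedin_generically_zero:
  assumes f: "meromorphic_cspace r f"
  shows "closedin (cspace r) {a. generically_zero_near r f a}" (is "closedin _ ?A")
proof -
  have "a \<in> ?A" if a: "a \<in> cspace r closure_of ?A" for a
  proof -
    have top: "a \<in> topspace (cspace r)"
      using a unfolding in_closure_of by (rule conjunct1)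
    obtain U g h where *: "a \<in> U" "holomorphic_in r g U" "holomorphic_in r h U"
      "generically_nonzero r h U" "\<And>z. z \<in> U \<Longrightarrow> h z \<noteq> 0 \<Longrightarrow> f z = g z / h z"
      using bspec[OF f[unfolded meromorphic_cspace_iff quotient_on_def] top] by blast
    obtain B where B: "\<And>k. k \<in> {1..r} \<Longrightarrow> open (B k)" "\<And>k. k \<in> {1..r} \<Longrightarrow> connected (B k)"
      "a \<in> Pi\<^sub>E {1..r} B" "Pi\<^sub>E {1..r} B \<subseteq> U"
      using openin_cspace_contains_box[OF holomorphic_in_openin[OF *(2)] *(1)] by metis
    let ?P = "Pi\<^sub>E {1..r} B"
    have P: "openin (cspace r) ?P"
      using B(1) by (rule openin_cspace_box)
    obtain b where b: "b \<in> ?P" "generically_zero_near r f b"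
      using a P B(3) unfolding in_closure_of mem_Collect_eq by meson
    obtain W where W: "openin (cspace r) W" "b \<in> W"
      "\<And>V. openin (cspace r) V \<Longrightarrow> V \<subseteq> W \<Longrightarrow> V \<noteq> {} \<Longrightarrow> \<exists>z\<in>V. f z = 0"
      using b(2) unfolding generically_zero_near_def by blast
    have o: "openin (cspace r) (W \<inter> ?P)"
      using W P by blast
    have hol: "holomorphic_in r g (W \<inter> ?P)"
      using o B(4) by (intro holomorphic_in_mono[OF *(2)]) auto
    \<comment> \<open>Otherwise \<open>g\<close> and \<open>h\<close> are both nonzero on a nonempty
      open part of \<open>W\<close>, where \<open>f = g / h\<close> has no zero.\<close>
    have g0: "g z = 0" if z: "z \<in> W \<inter> ?P" for z
    proof (rule ccontr)
      assume "g z \<noteq> 0"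
      define V where "V = {z \<in> W \<inter> ?P. g z \<noteq> 0}"
      have V: "openin (cspace r) V" "V \<noteq> {}" "V \<subseteq> U"
        using openin_holomorphic_nonzero[OF hol] z \<open>g z \<noteq> 0\<close> B(4) unfolding V_def by auto
      define V' where "V' = {z \<in> V. h z \<noteq> 0}"
      have "openin (cspace r) V'"
        unfolding V'_def using V by (intro openin_holomorphic_nonzero holomorphic_in_mono[OF *(3)])
      moreover have "V' \<noteq> {}"
        using V *(4) unfolding V'_def generically_nonzero_def by blast
      ultimately obtain y where "y \<in> V'" "f y = 0"
        using W(3)[of V'] unfolding V'_def V_def by blast
      then show False
        using *(5)[of y] V(3) unfolding V'_def V_def by auto
    qed
    have ne: "W \<inter> ?P \<noteq> {}"
      using b(1) W(2) by blast
    have gP: "g z = 0" if "z \<in> ?P" for z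
      by (rule holomorphic_in_box_identity[OF *(2) _ _ B(4) o ne Int_lower2 _ that])
        (erule B(1), erule B(2), erule g0)
    \<comment> \<open>Any point of \<open>V\<close> with \<open>h z \<noteq> 0\<close> is a zero of
      \<open>f\<close>, as the numerator vanishes on the box.\<close>
    have "\<exists>z\<in>V. f z = 0" if V: "openin (cspace r) V" "V \<subseteq> ?P" "V \<noteq> {}" for V
    proof -
      have "V \<subseteq> U"
        using V(2) B(4) by (rule subset_trans)
      then obtain z where z: "z \<in> V" "h z \<noteq> 0"
        using V(1,3) *(4) unfolding generically_nonzero_def by blast
      have "f z = 0"
        using z V(2) \<open>V \<subseteq> U\<close> gP[of z] *(5)[of z] by (simp add: subset_iff)
      then show ?thesis
        using z(1) by (rule bexI)
    qed
    then have "generically_zero_near r f a"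
      unfolding generically_zero_near_def using P B(3) by (intro exI[of _ ?P]) simp
    then show ?thesis
      by simp
  qed
  then show ?thesis
    using openin_subset[OF openin_generically_zero[of r f]]
    by (subst closure_of_subset_eq[symmetric]) blast
qed

proposition meromorphic_identity:
  assumes "meromorphic_cspace r f" "openin (cspace r) V" "V \<noteq> {}" "\<And>z. z \<in> V \<Longrightarrow> f z = 0"
    and s: "holomorphic_near r f s"
  shows "f s = 0"
proof (rule ccontr)
  assume nz: "f s \<noteq> 0"
  obtain U where U: "s \<in> U" "holomorphic_in r f U"
    using s unfolding holomorphic_near_def by blast
  have "connected_space (cspace r)"
    using connectedin_iff_connected[of "UNIV :: complex set"] connected_UNIV[where 'a = complex]
    unfolding connected_space_product_topology connectedin_def by simp
  moreover obtain v where v: "v \<in> V"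
    using assms by blast
  then have "generically_zero_near r f v"
    unfolding generically_zero_near_def using assms by blast
  \<comment> \<open>The set is clopen in a connected space and contains \<open>v\<close>.\<close>
  ultimately have "{a. generically_zero_near r f a} = topspace (cspace r)"
    using openin_generically_zero closedin_generically_zero[OF assms(1)]
    unfolding connected_space_clopen_in by blast
  then have "generically_zero_near r f s"
    using U holomorphic_in_subset_topspace by blast
  then obtain W where W: "openin (cspace r) W" "s \<in> W"
      "\<And>V. openin (cspace r) V \<Longrightarrow> V \<subseteq> W \<Longrightarrow> V \<noteq> {} \<Longrightarrow> \<exists>z\<in>V. f z = 0"
    unfolding generically_zero_near_def by blast
  \<comment> \<open>By continuity \<open>f\<close> has no zero near \<open>s\<close>, against the
    density of its zeros there.\<close>
  have "openin (cspace r) (W \<inter> {z \<in> U. f z \<noteq> 0})"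
    using W openin_holomorphic_nonzero[OF U(2)] by blast
  then show False
    using W(3)[of "W \<inter> {z \<in> U. f z \<noteq> 0}"] U(1) W(2) nz by blast
qed

section \<open>Continuations of series\<close>

text \<open>Beyond both thresholds, \<open>F\<close> and \<open>G\<close> are sums of the same
  series. Their difference thus vanishes on a product of half-planes, and the identity theorem
  carries this to \<open>s\<close>.\<close>

lemma meromorphic_continuation_unique:
  assumes F: "meromorphic_continuation r T F" "holomorphic_near r F s"
    and G: "meromorphic_continuation r T G" "holomorphic_near r G s"
  shows "F s = G s"
proof -
  obtain c where c: "\<And>z. z \<in> topspace (cspace r) \<Longrightarrow> (\<And>k. k \<in> {1..r} \<Longrightarrow> c < Re (z k)) \<Longrightarrow>
      (T z has_sum F z) ({1..r} \<rightarrow>\<^sub>E {1..})"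
    using F(1) unfolding meromorphic_continuation_def by blast
  obtain d where d: "\<And>z. z \<in> topspace (cspace r) \<Longrightarrow> (\<And>k. k \<in> {1..r} \<Longrightarrow> d < Re (z k)) \<Longrightarrow>
      (T z has_sum G z) ({1..r} \<rightarrow>\<^sub>E {1..})"
    using G(1) unfolding meromorphic_continuation_def by blast
  define V where "V = (\<Pi>\<^sub>E k\<in>{1..r}. {w. max c d < Re w})"
  have V: "openin (cspace r) V"
    unfolding V_def by (intro openin_cspace_box open_halfspace_Re_gt)
  have "of_real (max c d + 1) \<in> {w. max c d < Re w}"
    by (simp add: max_def)
  then have ne: "V \<noteq> {}"
    unfolding V_def by (subst PiE_eq_empty_iff) blast
  \<comment> \<open>The difference is written with a factor \<open>-1\<close> so that closure under
    sums and products covers it.\<close>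
  have eq: "F z + (-1) * G z = 0" if z: "z \<in> V" for z
  proof -
    have "z \<in> topspace (cspace r)"
      using V z openin_subset by blast
    moreover have "max c d < Re (z k)" if "k \<in> {1..r}" for k
      using z that unfolding V_def by blast
    ultimately have "F z = G z"
      using c[of z] d[of z] by (intro has_sum_unique) auto
    then show ?thesis
      by simp
  qed
  have "F s + (-1) * G s = 0"
  proof (rule meromorphic_identity[OF _ V ne eq])
    show "meromorphic_cspace r (\<lambda>z. F z + (-1) * G z)"
      using F(1) G(1) unfolding meromorphic_continuation_def
      by (intro meromorphic_cspace_add meromorphic_cspace_mult meromorphic_cspace_const) blast+
    have "s \<in> topspace (cspace r)"
      using F(2) holomorphic_in_subset_topspace unfolding holomorphic_near_def by blast
    then show "holomorphic_near r (\<lambda>z. F z + (-1) * G z) s"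
      using F(2) G(2) by (intro holomorphic_near_add holomorphic_near_mult holomorphic_near_const)
  qed
  then show ?thesis
    by simp
qed

text \<open>Uniqueness makes the definite description well defined, so any continuation holomorphic
  near \<open>s\<close> may be used to evaluate.\<close>

lemma continuation_value_eq:
  assumes "meromorphic_continuation r T F" "holomorphic_near r F s"
  shows "continuation_value r T s = F s"
  unfolding continuation_value_def
proof (rule the_equality)
  show "\<exists>G. meromorphic_continuation r T G \<and> holomorphic_near r G s \<and> G s = F s"
    using assms by (intro exI[of _ F]) simp
  fix v assume "\<exists>G. meromorphic_continuation r T G \<and> holomorphic_near r G s \<and> G s = v"
  then obtain G where G: "meromorphic_continuation r T G" "holomorphic_near r G s" "G s = v"
    by (elim exE conjE)
  then show "v = F s"
    using meromorphic_continuation_unique[OF G(1,2) assms] by simp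
qed

text \<open>Agreement is required only for positive \<open>m\<close>: the termwise expansion relies
  on nonzero partial sums.\<close>

lemma meromorphic_continuation_cong:
  assumes "\<And>s m. s \<in> topspace (cspace r) \<Longrightarrow> m \<in> {1..r} \<rightarrow>\<^sub>E {1..} \<Longrightarrow> T s m = T' s m"
  shows "meromorphic_continuation r T F \<longleftrightarrow> meromorphic_continuation r T' F"
proof -
  have "(T s has_sum F s) ({1..r} \<rightarrow>\<^sub>E {1..}) \<longleftrightarrow> (T' s has_sum F s) ({1..r} \<rightarrow>\<^sub>E {1..})"
    if "s \<in> topspace (cspace r)" for s
    using assms that by (intro has_sum_cong)
  then show ?thesis
    unfolding meromorphic_continuation_def by meson
qed

section \<open>Linear combinations and translates of continuations\<close>

lemma meromorphic_continuation_zero: "meromorphic_continuation r (\<lambda>_ _. 0) (\<lambda>_. 0)"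
  unfolding meromorphic_continuation_def 
  by (intro conjI meromorphic_cspace_const exI ballI impI has_sum_0) (rule refl)

lemma meromorphic_continuation_cmult:
  assumes "meromorphic_continuation r T F"
  shows "meromorphic_continuation r (\<lambda>s m. a * T s m) (\<lambda>s. a * F s)"
proof -
  obtain c where c: "\<forall>s\<in>topspace (cspace r). (\<forall>k\<in>{1..r}. c < Re (s k)) \<longrightarrow>
      (T s has_sum F s) ({1..r} \<rightarrow>\<^sub>E {1..})"
    using assms unfolding meromorphic_continuation_def by blast
  have "((\<lambda>m. a * T s m) has_sum a * F s) ({1..r} \<rightarrow>\<^sub>E {1..})"
    if "s \<in> topspace (cspace r)" "\<forall>k\<in>{1..r}. c < Re (s k)" for s
    using that c by (intro has_sum_cmult_right) blast
  moreover have "meromorphic_cspace r (\<lambda>s. a * F s)"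
    using assms unfolding meromorphic_continuation_def
    by (intro meromorphic_cspace_mult meromorphic_cspace_const) (elim conjE)
  ultimately show ?thesis
    unfolding meromorphic_continuation_def by (intro conjI) blast+
qed

lemma meromorphic_continuation_add:
  assumes "meromorphic_continuation r T F" "meromorphic_continuation r T' F'"
  shows "meromorphic_continuation r (\<lambda>s m. T s m + T' s m) (\<lambda>s. F s + F' s)"
proof -
  obtain c where c: "\<forall>s\<in>topspace (cspace r). (\<forall>k\<in>{1..r}. c < Re (s k)) \<longrightarrow>
      (T s has_sum F s) ({1..r} \<rightarrow>\<^sub>E {1..})"
    using assms(1) unfolding meromorphic_continuation_def by blast
  obtain d where d: "\<forall>s\<in>topspace (cspace r). (\<forall>k\<in>{1..r}. d < Re (s k)) \<longrightarrow>
      (T' s has_sum F' s) ({1..r} \<rightarrow>\<^sub>E {1..})"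
    using assms(2) unfolding meromorphic_continuation_def by blast
  have "((\<lambda>m. T s m + T' s m) has_sum F s + F' s) ({1..r} \<rightarrow>\<^sub>E {1..})"
    if "s \<in> topspace (cspace r)" "\<forall>k\<in>{1..r}. max c d < Re (s k)" for s
    using that c d by (intro has_sum_add) auto
  moreover have "meromorphic_cspace r (\<lambda>s. F s + F' s)"
    using assms unfolding meromorphic_continuation_def by (intro meromorphic_cspace_add) blast+
  ultimately show ?thesis
    unfolding meromorphic_continuation_def by (intro conjI) blast+
qed

lemma meromorphic_continuation_sum:
  assumes "finite I" "\<And>i. i \<in> I \<Longrightarrow> meromorphic_continuation r (T i) (F i)"
  shows "meromorphic_continuation r (\<lambda>s m. \<Sum>i\<in>I. T i s m) (\<lambda>s. \<Sum>i\<in>I. F i s)"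
  using assms
proof induction
  case (insert i I)
  have "meromorphic_continuation r (\<lambda>s m. T i s m + (\<Sum>i\<in>I. T i s m)) (\<lambda>s. F i s + (\<Sum>i\<in>I. F i s))"
    using insert by (intro meromorphic_continuation_add) simp_all
  then show ?case
    using insert.hyps by simp
qed (simp add: meromorphic_continuation_zero)

lemma holomorphic_near_sum:
  assumes "finite I" "s \<in> topspace (cspace r)" "\<And>i. i \<in> I \<Longrightarrow> holomorphic_near r (F i) s"
  shows "holomorphic_near r (\<lambda>s. \<Sum>i\<in>I. F i s) s"
  using assms(1,3)
proof induction
  case empty
  show ?case
    using holomorphic_near_const[OF assms(2)] by simp
next
  case (insert i I)
  have "holomorphic_near r (\<lambda>s. F i s + (\<Sum>i\<in>I. F i s)) s"
    using insert by (intro holomorphic_near_add) simp_all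
  then show ?case
    using insert.hyps by simp
qed

lemma meromorphic_continuation_translate:
  assumes "meromorphic_continuation r T F"
  shows "meromorphic_continuation r (\<lambda>s. T (translate r c s)) (\<lambda>s. F (translate r c s))"
proof -
  obtain d where d: "\<And>s. s \<in> topspace (cspace r) \<Longrightarrow> (\<And>k. k \<in> {1..r} \<Longrightarrow> d < Re (s k)) \<Longrightarrow>
      (T s has_sum F s) ({1..r} \<rightarrow>\<^sub>E {1..})"
    using assms unfolding meromorphic_continuation_def by blast
  \<comment> \<open>The sum of all \<bar>Re (c k)\<bar> bounds each single shift, so one threshold
    serves every coordinate.\<close>
  define e where "e = d + (\<Sum>k\<in>{1..r}. \<bar>Re (c k)\<bar>)"
  have "(T (translate r c s) has_sum F (translate r c s)) ({1..r} \<rightarrow>\<^sub>E {1..})"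
    if s: "\<forall>k\<in>{1..r}. e < Re (s k)" for s
  proof (rule d[OF translate_in_topspace])
    fix k assume k: "k \<in> {1..r}"
    have "\<bar>Re (c k)\<bar> \<le> (\<Sum>k\<in>{1..r}. \<bar>Re (c k)\<bar>)"
      using k by (intro member_le_sum) auto
    then have "d < Re (s k) + Re (c k)"
      using s k unfolding e_def by force
    then show "d < Re (translate r c s k)"
      using k by (simp add: translate_def)
  qed
  moreover have "meromorphic_cspace r (\<lambda>s. F (translate r c s))"
    using assms unfolding meromorphic_continuation_def by (intro meromorphic_cspace_translate) blast
  ultimately show ?thesis
    unfolding meromorphic_continuation_def by (intro conjI) blast+
qed

section \<open>The termwise identity\<close>

lemma finite_lower_pairs [simp]: "finite (lower_pairs r)"
  by (rule finite_subset[of _ "{..r} \<times> {..r}"]) (auto simp: lower_pairs_def)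

text \<open>A splitting is determined by \<open>q\<close>, since \<open>p\<close> is the difference
  \<open>l - q\<close>, exact because \<open>q x \<le> l x\<close>. Sums over splittings thus become
  sums over the choice functions that arise when a product of sums is expanded.\<close>

lemma bij_betw_splittings:
  "bij_betw (\<lambda>q. (\<lambda>x\<in>lower_pairs r. l x - q x, q)) (\<Pi>\<^sub>E x\<in>lower_pairs r. {..l x}) (splittings r l)"
proof (rule bij_betw_byWitness[where f' = snd])
  have "(\<lambda>x\<in>lower_pairs r. l x - q x) = p" if "(p, q) \<in> splittings r l" for p q
  proof
    fix x
    have "p \<in> lower_pairs r \<rightarrow>\<^sub>E UNIV" and sum: "\<forall>x\<in>lower_pairs r. p x + q x = l x"
      using that unfolding splittings_def by auto
    then have "p x = undefined" if "x \<notin> lower_pairs r"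
      using that by (intro PiE_arb)
    moreover have "l x - q x = p x" if "x \<in> lower_pairs r"
      using bspec[OF sum that] by simp
    ultimately show "(\<lambda>x\<in>lower_pairs r. l x - q x) x = p x"
      by simp
  qed
  then show "\<forall>x\<in>splittings r l. (\<lambda>q. (\<lambda>x\<in>lower_pairs r. l x - q x, q)) (snd x) = x"
    by auto
  show "snd ` splittings r l \<subseteq> (\<Pi>\<^sub>E x\<in>lower_pairs r. {..l x})"
  proof (rule image_subsetI)
    fix y assume y: "y \<in> splittings r l"
    obtain p q where y_eq: "y = (p, q)"
      by (rule prod.exhaust)
    then have pq: "(p, q) \<in> splittings r l"
      using y by (simp only:)
    show "snd y \<in> (\<Pi>\<^sub>E x\<in>lower_pairs r. {..l x})"
    proof (rule PiE_I)
      fix x assume "x \<in> lower_pairs r"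
      then have "p x + q x = l x"
        using pq unfolding splittings_def by blast
      then show "snd y x \<in> {..l x}"
        using y_eq by simp
    next
      fix x assume "x \<notin> lower_pairs r"
      moreover have "q \<in> lower_pairs r \<rightarrow>\<^sub>E UNIV"
        using pq unfolding splittings_def by blast
      ultimately have "q x = undefined"
        by (intro PiE_arb)
      then show "snd y x = undefined"
        using y_eq by simp
    qed
  qed
qed (auto simp: splittings_def PiE_iff)

lemma finite_splittings: "finite (splittings r l)"
  by (rule iffD1[OF bij_betw_finite[OF bij_betw_splittings]]) (intro finite_PiE finite_lower_pairs finite_atMost)

text \<open>Groups the pairs by second index, as the exponents \<open>p\<close> are in
  \<open>shifted_vars\<close>; the column \<open>k = 1\<close> is empty.\<close>

lemma prod_lower_pairs_columns:
  "(\<Prod>k=1..r. \<Prod>i=2..k. f i k) = (\<Prod>(i, j)\<in>lower_pairs r. f i j)" (is "?lhs = ?rhs")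
  for f :: "nat \<Rightarrow> nat \<Rightarrow> 'a::comm_monoid_mult"
proof -
  have "?lhs = (\<Prod>(k, i)\<in>(SIGMA k:{1..r}. {2..k}). f i k)"
    by (rule prod.Sigma) auto
  also have "\<dots> = ?rhs"
    by (rule prod.reindex_bij_witness[of _ "\<lambda>(i, j). (j, i)" "\<lambda>(k, i). (i, k)"])
      (auto simp: lower_pairs_def)
  finally show ?thesis .
qed

text \<open>Groups the pairs by first index \<open>i = k + 1\<close>, as the exponents
  \<open>q\<close> are in \<open>shifted_vars\<close>; the group for \<open>k = r\<close> is
  empty.\<close>

lemma prod_lower_pairs_rows:
  "(\<Prod>k=1..r. \<Prod>j=k+1..r. f (k + 1) j) = (\<Prod>(i, j)\<in>lower_pairs r. f i j)" (is "?lhs = ?rhs")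
  for f :: "nat \<Rightarrow> nat \<Rightarrow> 'a::comm_monoid_mult"
proof -
  have "?lhs = (\<Prod>(k, j)\<in>(SIGMA k:{1..r}. {k+1..r}). f (k + 1) j)"
    by (rule prod.Sigma) auto
  also have "\<dots> = ?rhs"
    by (rule prod.reindex_bij_witness[of _ "\<lambda>(i, j). (i - 1, j)" "\<lambda>(k, j). (k + 1, j)"])
      (auto simp: lower_pairs_def)
  finally show ?thesis .
qed

text \<open>Exponents add for a fixed branch of the logarithm, and natural exponents give ordinary
  powers. The base 0 is excluded, as \<open>0 powr 0\<close> is 0 but \<open>0 ^ 0\<close> is
  1.\<close>

lemma powr_minus_diff_of_nat:
  fixes z a :: complex
  assumes "z \<noteq> 0"
  shows "z powr (- (a - of_nat m - of_nat n)) = z powr (- a) * z ^ m * z ^ n"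
proof -
  have "- (a - of_nat m - of_nat n) = - a + of_nat m + of_nat n"
    by simp
  then show ?thesis
    using assms by (simp only: powr_add powr_nat if_False)
qed

text \<open>The shift at \<open>k\<close> contributes powers of \<open>M k\<close> from column
  \<open>k\<close> of \<open>p\<close> and from row \<open>k + 1\<close> of \<open>q\<close>.
  Regrouped by pairs, \<open>(i, j)\<close> receives \<open>M j\<close> from its column and
  \<open>M (i - 1)\<close> from its row.\<close>

lemma zeta_EZ_term_shifted_vars:
  fixes m :: "nat \<Rightarrow> nat"
  defines "M \<equiv> \<lambda>k. of_nat (\<Sum>i=1..k. m i) :: complex"
  assumes nz: "\<And>k. k \<in> {1..r} \<Longrightarrow> M k \<noteq> 0"
  shows "zeta_EZ_term r (shifted_vars r s p q) m =
    (\<Prod>k=1..r. M k powr (- s k)) * (\<Prod>(i, j)\<in>lower_pairs r. M j ^ p (i, j) * M (i - 1) ^ q (i, j))"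
proof -
  have "zeta_EZ_term r (shifted_vars r s p q) m =
      (\<Prod>k=1..r. M k powr (- s k) * (\<Prod>i=2..k. M k ^ p (i, k)) * (\<Prod>j=k+1..r. M k ^ q (k + 1, j)))"
    unfolding zeta_EZ_term_def
  proof (rule prod.cong)
    fix k assume k: "k \<in> {1..r}"
    have "of_nat (\<Sum>i=1..k. m i) powr (- shifted_vars r s p q k) =
        M k powr (- (s k - of_nat (\<Sum>i=2..k. p (i, k)) - of_nat (\<Sum>j=k+1..r. q (k + 1, j))))"
      using k by (simp add: M_def shifted_vars_def)
    also have "\<dots> = M k powr (- s k) * M k ^ (\<Sum>i=2..k. p (i, k)) * M k ^ (\<Sum>j=k+1..r. q (k + 1, j))"
      using nz[OF k] by (rule powr_minus_diff_of_nat)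
    finally show "of_nat (\<Sum>i=1..k. m i) powr (- shifted_vars r s p q k) =
        M k powr (- s k) * (\<Prod>i=2..k. M k ^ p (i, k)) * (\<Prod>j=k+1..r. M k ^ q (k + 1, j))"
      by (simp add: power_sum)
  qed simp
  \<comment> \<open>The index \<open>k + 1 - 1\<close> exhibits the factor as a function of the row
    number \<open>k + 1\<close>, as the regrouping by rows requires.\<close>
  also have "\<dots> = (\<Prod>k=1..r. M k powr (- s k)) *
      ((\<Prod>k=1..r. \<Prod>i=2..k. M k ^ p (i, k)) * (\<Prod>k=1..r. \<Prod>j=k+1..r. M (k + 1 - 1) ^ q (k + 1, j)))"
    by (simp add: prod.distrib mult.assoc)
  also have "\<dots> = (\<Prod>k=1..r. M k powr (- s k)) *
      ((\<Prod>(i, j)\<in>lower_pairs r. M j ^ p (i, j)) * (\<Prod>(i, j)\<in>lower_pairs r. M (i - 1) ^ q (i, j)))"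
    by (simp only: prod_lower_pairs_columns[of "\<lambda>i j. M j ^ p (i, j)"]
        prod_lower_pairs_rows[of "\<lambda>i j. M (i - 1) ^ q (i, j)"])
  finally show ?thesis
    by (simp add: prod.distrib case_prod_unfold)
qed

text \<open>For \<open>i = 1\<close> the inner sum is \<open>M j\<close>, giving the Euler-Zagier
  factors; for \<open>i \<ge> 2\<close> it is a difference of two partial sums, raised to a natural
  power.\<close>

lemma zeta_A_term_first_row_vars:
  fixes m :: "nat \<Rightarrow> nat"
  defines "M \<equiv> \<lambda>k. of_nat (\<Sum>i=1..k. m i) :: complex"
  assumes m: "\<And>k. k \<in> {1..r} \<Longrightarrow> m k \<noteq> 0"
  shows "zeta_A_term r (first_row_vars l s) m =
    (\<Prod>k=1..r. M k powr (- s k)) * (\<Prod>(i, j)\<in>lower_pairs r. (M j - M (i - 1)) ^ l (i, j))"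
proof -
  let ?t = "\<lambda>(i, j). of_nat (\<Sum>k=i..j. m k) powr (- first_row_vars l s (i, j))"
  have pairs: "{(i, j). 1 \<le> i \<and> i \<le> j \<and> j \<le> r} = Pair 1 ` {1..r} \<union> lower_pairs r"
    by (auto simp: lower_pairs_def)
  have "zeta_A_term r (first_row_vars l s) m = prod ?t (Pair 1 ` {1..r}) * prod ?t (lower_pairs r)"
    unfolding zeta_A_term_def pairs
    by (intro prod.union_disjoint finite_imageI finite_atLeastAtMost finite_lower_pairs)
      (auto simp: lower_pairs_def)
  moreover have "prod ?t (Pair 1 ` {1..r}) = (\<Prod>k=1..r. M k powr (- s k))"
    by (subst prod.reindex) (auto simp: inj_on_def M_def first_row_vars_def)
  moreover have "prod ?t (lower_pairs r) = (\<Prod>(i, j)\<in>lower_pairs r. (M j - M (i - 1)) ^ l (i, j))"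
  proof (rule prod.cong[OF refl], clarify)
    fix i j assume "(i, j) \<in> lower_pairs r"
    then have ij: "2 \<le> i" "i \<le> j" "j \<le> r"
      by (auto simp: lower_pairs_def)
    have "{1..j} = {1..i-1} \<union> {i..j}"
      using ij by auto
    then have "M j = M (i - 1) + of_nat (\<Sum>k=i..j. m k)"
      using ij by (simp add: M_def sum.union_disjoint del: of_nat_sum flip: of_nat_add)
    \<comment> \<open>The summand \<open>m i\<close> is already nonzero, so \<open>powr\<close> with
      a natural exponent is the ordinary power, even for exponent 0.\<close>
    moreover have "(\<Sum>k=i..j. m k) \<noteq> 0"
      using ij m[of i] by (auto simp: sum_eq_0_iff)
    then have "of_nat (\<Sum>k=i..j. m k) \<noteq> (0 :: complex)"
      by (simp only: of_nat_eq_0_iff not_False_eq_True)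
    then have "of_nat (\<Sum>k=i..j. m k) powr (of_nat (l (i, j)) :: complex) = of_nat (\<Sum>k=i..j. m k) ^ l (i, j)"
      by (simp only: powr_nat if_False)
    ultimately show "of_nat (\<Sum>k=i..j. m k) powr (- first_row_vars l s (i, j)) = (M j - M (i - 1)) ^ l (i, j)"
      using ij by (simp add: first_row_vars_def)
  qed
  ultimately show ?thesis
    by (simp only:)
qed

text \<open>
  Binomial expansion of $m_i + \cdots + m_j = (m_1 + \cdots + m_j) - (m_1 + \cdots + m_{i-1})$.
\<close>

lemma zeta_A_term_eq_sum_zeta_EZ_term:
  assumes m: "m \<in> {1..r} \<rightarrow>\<^sub>E {1..}"
  shows "zeta_A_term r (first_row_vars l s) m =
    (\<Sum>(p, q)\<in>splittings r l.
      (\<Prod>x\<in>lower_pairs r. of_nat (l x choose q x) * (-1) ^ q x) *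
      zeta_EZ_term r (shifted_vars r s p q) m)"
proof -
  define M where "M = (\<lambda>k. of_nat (\<Sum>i=1..k. m i) :: complex)"
  \<comment> \<open>The summands of the binomial expansion: \<open>n\<close> is the exponent
    \<open>q\<close> on \<open>M (i - 1)\<close>, and the complementary exponent on
    \<open>M j\<close> is \<open>p\<close>.\<close>
  define t where "t = (\<lambda>(i, j) n. of_nat (l (i, j) choose n) * (-1) ^ n *
    (M j ^ (l (i, j) - n) * M (i - 1) ^ n))"
  have m_pos: "m k \<noteq> 0" if "k \<in> {1..r}" for k
    using PiE_mem[OF m that] by simp
  \<comment> \<open>Every partial sum with \<open>k \<ge> 1\<close> contains the nonzero summand
    \<open>m 1\<close>.\<close>
  have M_nz: "M k \<noteq> 0" if "k \<in> {1..r}" for k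
    using that m_pos[of 1] unfolding M_def of_nat_eq_0_iff by (auto simp: sum_eq_0_iff)
  have "(\<Prod>(i, j)\<in>lower_pairs r. (M j - M (i - 1)) ^ l (i, j)) = (\<Prod>x\<in>lower_pairs r. \<Sum>n\<le>l x. t x n)"
  proof (rule prod.cong[OF refl], clarify)
    fix i j
    \<comment> \<open>This order of the summands puts \<open>n\<close>, and with it the sign, on
      \<open>M (i - 1)\<close>.\<close>
    have "(M j - M (i - 1)) ^ l (i, j) = (- M (i - 1) + M j) ^ l (i, j)"
      by simp
    also have "\<dots> = (\<Sum>n\<le>l (i, j). of_nat (l (i, j) choose n) * (- M (i - 1)) ^ n * M j ^ (l (i, j) - n))"
      by (rule binomial_ring)
    finally show "(M j - M (i - 1)) ^ l (i, j) = (\<Sum>n\<le>l (i, j). t (i, j) n)"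
      by (simp add: t_def power_minus[of "M (i - 1)"] mult_ac)
  qed
  \<comment> \<open>Distributivity: choosing one summand from every factor amounts to choosing a
    family \<open>q\<close>.\<close>
  also have "\<dots> = (\<Sum>q\<in>(\<Pi>\<^sub>E x\<in>lower_pairs r. {..l x}). \<Prod>x\<in>lower_pairs r. t x (q x))"
    by (intro prod_sum_PiE) auto
  \<comment> \<open>The summand is put in the form of a function of \<open>(p, q)\<close> evaluated
    at the image of \<open>q\<close>, ready for reindexing along the bijection.\<close>
  also have "\<dots> = (\<Sum>q\<in>(\<Pi>\<^sub>E x\<in>lower_pairs r. {..l x}).
      (\<lambda>(p, q). (\<Prod>x\<in>lower_pairs r. of_nat (l x choose q x) * (-1) ^ q x) *
        (\<Prod>(i, j)\<in>lower_pairs r. M j ^ p (i, j) * M (i - 1) ^ q (i, j)))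
      (\<lambda>x\<in>lower_pairs r. l x - q x, q))"
    unfolding case_prod_conv prod.distrib[symmetric] by (intro sum.cong prod.cong) (auto simp: t_def)
  also have "\<dots> = (\<Sum>(p, q)\<in>splittings r l.
      (\<Prod>x\<in>lower_pairs r. of_nat (l x choose q x) * (-1) ^ q x) *
      (\<Prod>(i, j)\<in>lower_pairs r. M j ^ p (i, j) * M (i - 1) ^ q (i, j)))"
    by (rule sum.reindex_bij_betw[OF bij_betw_splittings])
  finally have "(\<Prod>(i, j)\<in>lower_pairs r. (M j - M (i - 1)) ^ l (i, j)) = (\<Sum>(p, q)\<in>splittings r l.
      (\<Prod>x\<in>lower_pairs r. of_nat (l x choose q x) * (-1) ^ q x) *
      (\<Prod>(i, j)\<in>lower_pairs r. M j ^ p (i, j) * M (i - 1) ^ q (i, j)))" .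
  moreover have "zeta_A_term r (first_row_vars l s) m =
      (\<Prod>k=1..r. M k powr (- s k)) * (\<Prod>(i, j)\<in>lower_pairs r. (M j - M (i - 1)) ^ l (i, j))"
    unfolding M_def by (rule zeta_A_term_first_row_vars) (rule m_pos)
  moreover have "zeta_EZ_term r (shifted_vars r s p q) m = (\<Prod>k=1..r. M k powr (- s k)) *
      (\<Prod>(i, j)\<in>lower_pairs r. M j ^ p (i, j) * M (i - 1) ^ q (i, j))" for p q
    unfolding M_def by (rule zeta_EZ_term_shifted_vars) (rule M_nz[unfolded M_def])
  ultimately show ?thesis
    by (simp add: sum_distrib_left case_prod_unfold mult_ac)
qed

text \<open>The translation vector does not depend on \<open>s\<close>, so continuations and
  holomorphy pass to the shifted arguments.\<close>

lemma shifted_vars_eq_translate: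
  "shifted_vars r s p q =
    translate r (\<lambda>k. - (\<Sum>i=2..k. of_nat (p (i, k))) - (\<Sum>j=k+1..r. of_nat (q (k + 1, j)))) s"
  unfolding shifted_vars_def translate_def by (intro restrict_ext) simp

section \<open>Combining the continuations of the shifted series\<close>

theorem lemma14:
  fixes r :: nat and l :: "nat \<times> nat \<Rightarrow> nat"
  assumes "1 \<le> r"
  shows "\<forall>s\<in>topspace (cspace r).
    (\<forall>(p, q)\<in>splittings r l. zeta_EZ_regular r (shifted_vars r s p q)) \<longrightarrow>
      zeta_A_row_regular r l s \<and>
      zeta_A_row r l s =
        (\<Sum>(p, q)\<in>splittings r l.
          (\<Prod>x\<in>lower_pairs r. of_nat (l x choose q x) * (-1) ^ q x) *
          zeta_EZ r (shifted_vars r s p q))"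
proof (intro ballI impI)
  fix s assume s: "s \<in> topspace (cspace r)"
    and reg: "\<forall>(p, q)\<in>splittings r l. zeta_EZ_regular r (shifted_vars r s p q)"
  define a :: "(nat \<times> nat \<Rightarrow> nat) \<times> (nat \<times> nat \<Rightarrow> nat) \<Rightarrow> complex"
    where "a = (\<lambda>(p, q). \<Prod>x\<in>lower_pairs r. of_nat (l x choose q x) * (-1) ^ q x)"
  define v where "v = (\<lambda>(p, q) s. shifted_vars r s p q)"
  have "\<exists>F. meromorphic_continuation r (zeta_EZ_term r) F \<and> holomorphic_near r F (v x s)"
    if "x \<in> splittings r l" for x
    using reg that unfolding zeta_EZ_regular_def continuation_regular_def v_def by fastforce
  \<comment> \<open>Regularity at each shifted point may supply a different continuation of the
    Euler-Zagier series, so \<open>F\<close> depends on the splitting.\<close>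
  then obtain F where F: "\<And>x. x \<in> splittings r l \<Longrightarrow> meromorphic_continuation r (zeta_EZ_term r) (F x)"
    "\<And>x. x \<in> splittings r l \<Longrightarrow> holomorphic_near r (F x) (v x s)"
    by metis
  have v: "\<exists>c. v x = translate r c" for x
    unfolding v_def shifted_vars_eq_translate by (cases x) auto
  define G where "G = (\<lambda>s. \<Sum>x\<in>splittings r l. a x * F x (v x s))"
  have term_eq: "zeta_A_term r (first_row_vars l s) m =
      (\<Sum>x\<in>splittings r l. a x * zeta_EZ_term r (v x s) m)"
    if "m \<in> {1..r} \<rightarrow>\<^sub>E {1..}" for s m
    using zeta_A_term_eq_sum_zeta_EZ_term[OF that] by (simp add: a_def v_def case_prod_unfold)
  have "meromorphic_continuation r (\<lambda>s m. \<Sum>x\<in>splittings r l. a x * zeta_EZ_term r (v x s) m) G"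
    unfolding G_def
  proof (intro meromorphic_continuation_sum meromorphic_continuation_cmult finite_splittings)
    fix x assume x: "x \<in> splittings r l"
    obtain c where "v x = translate r c"
      using v by (rule exE)
    then show "meromorphic_continuation r (\<lambda>s. zeta_EZ_term r (v x s)) (\<lambda>s. F x (v x s))"
      using meromorphic_continuation_translate[OF F(1)[OF x]] by (simp only:)
  qed
  \<comment> \<open>The two series agree term by term on positive \<open>m\<close>, so
    \<open>G\<close> continues both.\<close>
  then have G: "meromorphic_continuation r (\<lambda>s. zeta_A_term r (first_row_vars l s)) G"
    by (subst meromorphic_continuation_cong[OF term_eq])
  have near: "holomorphic_near r G s"
    unfolding G_def
  proof (intro holomorphic_near_sum holomorphic_near_mult holomorphic_near_const finite_splittings s)
    fix x assume x: "x \<in> splittings r l"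
    obtain c where "v x = translate r c"
      using v by (rule exE)
    then show "holomorphic_near r (\<lambda>s. F x (v x s)) s"
      using F(2)[OF x] holomorphic_near_translate[OF _ s] by (simp only:)
  qed
  \<comment> \<open>At its own shifted point each \<open>F x\<close> is holomorphic, so its value
    there is that of \<open>zeta_EZ\<close>, whichever continuation was chosen.\<close>
  have "G s = (\<Sum>x\<in>splittings r l. a x * zeta_EZ r (v x s))"
    unfolding G_def zeta_EZ_def
    by (intro sum.cong refl arg_cong2[of _ _ _ _ "(*)"] continuation_value_eq[symmetric] F)
  then show "zeta_A_row_regular r l s \<and> zeta_A_row r l s =
      (\<Sum>(p, q)\<in>splittings r l.
        (\<Prod>x\<in>lower_pairs r. of_nat (l x choose q x) * (-1) ^ q x) *
        zeta_EZ r (shifted_vars r s p q))"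
    using G near continuation_value_eq[OF G near]
    unfolding zeta_A_row_regular_def continuation_regular_def zeta_A_row_def
    by (intro conjI exI[of _ G]) (simp_all add: a_def v_def case_prod_unfold)
qed

end
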